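(* Let $q$ be a prime power, let $k, L, n$ be integers with $1 \le L \le k$, $n = 2k-L$ and $n \le q-1$, and let $\alpha_1,\dots,\alpha_n$ be distinct nonzero elements of $\mathbf{F}_q$. Then for every $\vec{s} \in \mathbf{F}_q^L$, the advance-sharing encoding procedure and the original encoding procedure (both defined in the context) applied to the quantum secret $|\vec{s}\rangle$ give the same quantum state of the $n$ shares, i.e. $$\left(I \otimes U_{\mathrm{enc}}\right)\left(|\Psi\rangle \otimes |\vec{s}\rangle\right) = \frac{1}{\sqrt{q^{k-L}}}\sum_{\vec{c}\in D(\vec{s})} |f_{\vec{c}}(\alpha_1)\rangle \otimes |f_{\vec{c}}(\alpha_2)\rangle \otimes \cdots \otimes |f_{\vec{c}}(\alpha_n)\rangle$$ in $\mathcal{H}_q^{\otimes n}$, where $I$ is the identity on the first $k-L$ qudits of $|\Psi\rangle$ and $U_{\mathrm{enc}}$ acts on the last $k-L$ qudits of $|\Psi\rangle$ together with the $L$ qudits of $|\vec{s}\rangle$.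
   Context: $\mathbf{F}_q$ is the finite field with $q$ elements. $\mathcal{H}_q$ is a $q$-dimensional complex Hilbert space (a qudit) with orthonormal basis $\{|i\rangle : i \in \mathbf{F}_q\}$. For a vector $\vec{v}=(v_1,\dots,v_m) \in \mathbf{F}_q^m$ write $|\vec{v}\rangle = |v_1\rangle\otimes\cdots\otimes|v_m\rangle \in \mathcal{H}_q^{\otimes m}$. For $\vec{c}=(c_1,\dots,c_k)\in\mathbf{F}_q^k$ let $f_{\vec{c}}(x) = c_1 + c_2 x + \cdots + c_k x^{k-1}$. For $\vec{s}=(s_1,\dots,s_L)\in\mathbf{F}_q^L$ let $D(\vec{s})$ be the set of $\vec{c}\in\mathbf{F}_q^k$ with $c_i = s_i$ for $i=1,\dots,L$. Original encoding procedure (the $(k,L,n)$ ramp quantum secret sharing scheme of Ogawa et al.): the secret $|\vec{s}\rangle$ is encoded into the $n$-qudit state $\frac{1}{\sqrt{q^{k-L}}}\sum_{\vec{c}\in D(\vec{s})} |f_{\vec{c}}(\alpha_1)\rangle \otimes \cdots \otimes |f_{\vec{c}}(\alpha_n)\rangle$, whose $i$-th qudit is the $i$-th share. Advance-sharing encoding procedure: let $$|\Psi\rangle = \frac{1}{\sqrt{q^{k-L}}}\sum_{\vec{r}\in\mathbf{F}_q^{k-L}} |\vec{r}\rangle\otimes|\vec{r}\rangle \in \mathcal{H}_q^{\otimes 2(k-L)}.$$ For $\vec{r}=(r_1,\dots,r_{k-L})\in\mathbf{F}_q^{k-L}$ and $\vec{s}\in\mathbf{F}_q^L$, let $g_{\vec{r},\vec{s}}(x)$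 be the unique polynomial in $\{f_{\vec{c}}(x) : \vec{c}\in D(\vec{s})\}$ with $g_{\vec{r},\vec{s}}(\alpha_i) = r_i$ for $i=1,\dots,k-L$. Let $U_{\mathrm{enc}} : \mathcal{H}_q^{\otimes k} \to \mathcal{H}_q^{\otimes (n-k+L)}$ (note $n-k+L=k$) be the unitary map determined by $|\vec{r}\rangle|\vec{s}\rangle \mapsto |g_{\vec{r},\vec{s}}(\alpha_{k-L+1})\rangle\otimes\cdots\otimes|g_{\vec{r},\vec{s}}(\alpha_n)\rangle$ for all $\vec{r}\in\mathbf{F}_q^{k-L}$, $\vec{s}\in\mathbf{F}_q^L$. The dealer first distributes the first (left) $k-L$ qudits of $|\Psi\rangle$ as shares $1,\dots,k-L$; once $|\vec{s}\rangle$ is given, the dealer applies $U_{\mathrm{enc}}$ to the remaining $k-L$ qudits of $|\Psi\rangle$ and $|\vec{s}\rangle$, and the resulting $n-k+L$ qudits are shares $k-L+1,\dots,n$. *)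

theory Defs
  imports
    "HOL-Analysis.Analysis"
    "HOL-Computational_Algebra.Polynomial"
    "HOL-Number_Theory.Prime_Powers"
    "HOL-Library.Function_Algebras"
begin

section \<open>Qudit states\<close>

text \<open>
  The field is a finite type \<open>'a\<close> of class \<open>field\<close>. Vectors over it are lists, so that their
  length may vary. The space of \<open>m\<close> qudits consists of the
  amplitude functions on lists that vanish off the lists of length \<open>m\<close>. Addition, zero and sums
  of states are pointwise.
\<close>

type_synonym 'a state = "'a list \<Rightarrow> complex"

definition vecs :: "nat \<Rightarrow> 'a list set" where
  "vecs m = {v. length v = m}"

definition qudits :: "nat \<Rightarrow> 'a state set" where
  "qudits m = {\<phi>. \<forall>v. length v \<noteq> m \<longrightarrow> \<phi> v = 0}"

definition scal :: "complex \<Rightarrow> 'a state \<Rightarrow> 'a state" (infixr "*\<^sub>Q" 75) where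
  "a *\<^sub>Q \<phi> = (\<lambda>v. a * \<phi> v)"

definition braket :: "nat \<Rightarrow> 'a state \<Rightarrow> 'a state \<Rightarrow> complex" where
  "braket m \<phi> \<psi> = (\<Sum>v\<in>vecs m. cnj (\<phi> v) * \<psi> v)"

text \<open>
  For \<open>\<phi>\<close> in the space of \<open>m\<close> qudits only the summand \<open>i = m\<close> below can be nonzero, and the value
  is the usual product of amplitudes; see \<open>tensor_append\<close>. Summing over all splittings avoids
  carrying the number of qudits of the factors around.
\<close>

definition tensor :: "'a state \<Rightarrow> 'a state \<Rightarrow> 'a state" (infixr "\<otimes>\<^sub>Q" 70) where
  "\<phi> \<otimes>\<^sub>Q \<psi> = (\<lambda>v. \<Sum>i\<le>length v. \<phi> (take i v) * \<psi> (drop i v))"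

definition basis_ket :: "'a \<Rightarrow> 'a state" where
  "basis_ket a = (\<lambda>v. if v = [a] then 1 else 0)"

primrec ket :: "'a list \<Rightarrow> 'a state" where
  "ket [] = (\<lambda>v. if v = [] then 1 else 0)"
| "ket (a # v) = basis_ket a \<otimes>\<^sub>Q ket v"

text \<open>The tensor product of an operator on \<open>m\<close> qudits and an operator on \<open>m'\<close> qudits, as the linear
  extension of its values on the basis.\<close>

definition op_tensor ::
  "nat \<Rightarrow> nat \<Rightarrow> ('a state \<Rightarrow> 'a state) \<Rightarrow> ('a state \<Rightarrow> 'a state) \<Rightarrow> 'a state \<Rightarrow> 'a state" where
  "op_tensor m m' A B \<psi> =
     (\<Sum>x\<in>vecs m. \<Sum>y\<in>vecs m'. \<psi> (x @ y) *\<^sub>Q (A (ket x) \<otimes>\<^sub>Q B (ket y)))"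

definition unitary_map :: "nat \<Rightarrow> nat \<Rightarrow> ('a state \<Rightarrow> 'a state) \<Rightarrow> bool" where
  "unitary_map m m' U \<longleftrightarrow>
     (\<forall>\<phi>\<in>qudits m. \<forall>\<psi>\<in>qudits m. U (\<phi> + \<psi>) = U \<phi> + U \<psi>) \<and>
     (\<forall>a. \<forall>\<phi>\<in>qudits m. U (a *\<^sub>Q \<phi>) = a *\<^sub>Q U \<phi>) \<and>
     U ` qudits m = qudits m' \<and>
     (\<forall>\<phi>\<in>qudits m. \<forall>\<psi>\<in>qudits m. braket m' (U \<phi>) (U \<psi>) = braket m \<phi> \<psi>)"

section \<open>The two encoding procedures\<close>

text \<open>The polynomial \<open>f\<^sub>c\<close> is \<open>Poly c\<close>, and \<open>\<alpha>\<close> is the list of evaluation points.\<close>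

definition D :: "nat \<Rightarrow> nat \<Rightarrow> 'a list \<Rightarrow> 'a list set" where
  "D k L s = {c \<in> vecs k. \<forall>i<L. c ! i = s ! i}"

definition Psi :: "nat \<Rightarrow> 'a::finite state" where
  "Psi m = complex_of_real (1 / sqrt (real (CARD('a) ^ m))) *\<^sub>Q (\<Sum>r\<in>vecs m. ket r \<otimes>\<^sub>Q ket r)"

definition g_poly :: "nat \<Rightarrow> nat \<Rightarrow> 'a list \<Rightarrow> 'a list \<Rightarrow> 'a list \<Rightarrow> 'a::field poly" where
  "g_poly k L \<alpha> r s = (THE p. p \<in> Poly ` D k L s \<and> map (poly p) (take (k - L) \<alpha>) = r)"

text \<open>The linear extension of its values on the basis; unitarity is \<open>unitary_U_enc\<close>.\<close>

definition U_enc :: "nat \<Rightarrow> nat \<Rightarrow> 'a list \<Rightarrow> 'a::{finite,field} state \<Rightarrow> 'a state" where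
  "U_enc k L \<alpha> \<psi> =
     (\<Sum>r\<in>vecs (k - L). \<Sum>s\<in>vecs L.
        \<psi> (r @ s) *\<^sub>Q ket (map (poly (g_poly k L \<alpha> r s)) (drop (k - L) \<alpha>)))"

section \<open>Well-definedness\<close>

lemma finite_vecs [simp]: "finite (vecs m :: 'a::finite list set)"
  using finite_lists_length_eq[of "UNIV :: 'a set" m] by (simp add: vecs_def)

lemma sum_state_apply: "(\<Sum>x\<in>A. F x :: 'a state) v = (\<Sum>x\<in>A. F x v)"
  by (induction A rule: infinite_finite_induct) auto

lemma ket_eq: "ket v = (\<lambda>w. if w = v then 1 else 0)"
proof (induction v)
  case (Cons a v)
  have "ket (a # v) w = (if w = a # v then 1 else 0)" for w
  proof -
    have "ket (a # v) w = (\<Sum>i\<le>length w. (if take i w = [a] then 1 else 0) *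
        (if drop i w = v then 1 else 0))"
      by (simp add: tensor_def basis_ket_def Cons.IH)
    also have "\<dots> = (\<Sum>i\<le>length w. if i = 1 then (if w = a # v then 1 else 0) else 0)"
    proof (rule sum.cong[OF refl])
      fix i assume i: "i \<in> {..length w}"
      have "take i w = [a] \<and> drop i w = v \<longleftrightarrow> i = 1 \<and> w = a # v"
      proof
        assume h: "take i w = [a] \<and> drop i w = v"
        have "length (take i w) = i" using i by simp
        moreover have "w = take i w @ drop i w" by simp
        ultimately show "i = 1 \<and> w = a # v" using h by simp
      qed auto
      then show "(if take i w = [a] then 1 else 0) * (if drop i w = v then 1 else 0) =
          (if i = 1 then (if w = a # v then 1 else 0) else (0::complex))"
        by auto
    qed
    also have "\<dots> = (if w = a # v then 1 else 0)"
      by (auto simp: sum.delta)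
    finally show ?thesis .
  qed
  then show ?case by blast
qed simp

lemma tensor_append:
  assumes "\<phi> \<in> qudits m" "length x = m"
  shows "(\<phi> \<otimes>\<^sub>Q \<psi>) (x @ y) = \<phi> x * \<psi> y"
proof -
  have "(\<phi> \<otimes>\<^sub>Q \<psi>) (x @ y) =
      (\<Sum>i\<le>length (x @ y). if i = m then \<phi> x * \<psi> y else 0)"
    unfolding tensor_def using assms by (intro sum.cong refl) (auto simp: qudits_def)
  also have "\<dots> = \<phi> x * \<psi> y"
    using assms(2) by (subst sum.delta) auto
  finally show ?thesis .
qed

lemma Poly_eq_iff_length:
  assumes "length c = length c'" shows "Poly c = Poly c' \<longleftrightarrow> c = c'"
proof
  assume "Poly c = Poly c'"
  then have "nth_default 0 c = nth_default 0 c'" by (metis coeff_Poly_eq)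
  then show "c = c'" using assms by (metis nth_default_nth nth_equalityI)
qed simp

lemma eval_inj:
  fixes as :: "'a::field list"
  assumes "distinct as" "length as = m" "length c = m" "length c' = m"
    and "\<And>a. a \<in> set as \<Longrightarrow> poly (Poly c) a = poly (Poly c') a"
  shows "c = c'"
proof (cases "m = 0")
  case False
  have "degree (Poly c) < m" if "length c = m" for c :: "'a list"
    by (rule degree_lessI) (use False that in \<open>auto simp: nth_default_beyond\<close>)
  then have "Poly c = Poly c'"
    using assms by (intro poly_eqI_degree[of "set as"]) (auto simp: distinct_card)
  then show ?thesis using assms by (simp add: Poly_eq_iff_length)
qed (use assms in auto)

lemma D_eq:
  assumes "L \<le> k" "length s = L"
  shows "D k L s = (\<lambda>t. s @ t) ` vecs (k - L)"
proof (intro set_eqI iffI)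
  fix c assume c: "c \<in> D k L s"
  then have "c = s @ drop L c"
    using assms by (auto simp: D_def vecs_def intro!: nth_equalityI simp: nth_append)
  then show "c \<in> (\<lambda>t. s @ t) ` vecs (k - L)"
    using c by (intro image_eqI[of _ _ "drop L c"]) (auto simp: D_def vecs_def)
qed (use assms in \<open>auto simp: D_def vecs_def nth_append\<close>)

lemma g_poly_ex1:
  fixes \<alpha> :: "'a::{finite,field} list"
  assumes "L \<le> k" "k - L \<le> length \<alpha>" "distinct \<alpha>" "0 \<notin> set \<alpha>"
    and r: "r \<in> vecs (k - L)" and s: "s \<in> vecs L"
  shows "\<exists>!p. p \<in> Poly ` D k L s \<and> map (poly p) (take (k - L) \<alpha>) = r"
proof -
  let ?as = "take (k - L) \<alpha>"
  define E where "E t = map (poly (Poly (s @ t))) ?as" for t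
  have nz: "a \<noteq> 0" if "a \<in> set ?as" for a
    using that assms(4) by (meson in_set_takeD)
  have inj: "inj_on E (vecs (k - L))"
  proof (rule inj_onI)
    fix t t' assume t: "t \<in> vecs (k - L)" "t' \<in> vecs (k - L)" "E t = E t'"
    have "poly (Poly t) a = poly (Poly t') a" if a: "a \<in> set ?as" for a
    proof -
      have "poly (Poly (s @ t)) a = poly (Poly (s @ t')) a"
        using t(3) a by (auto simp: E_def)
      then show ?thesis using nz[OF a] by (auto simp: Poly_append poly_monom)
    qed
    then show "t = t'"
      using t assms by (intro eval_inj[of ?as "k - L"]) (auto simp: vecs_def)
  qed
  have "E ` vecs (k - L) \<subseteq> vecs (k - L)"
    using assms(2) by (auto simp: E_def vecs_def)
  then have "E ` vecs (k - L) = vecs (k - L)"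
    by (rule endo_inj_surj[OF finite_vecs _ inj])
  then obtain t where t: "t \<in> vecs (k - L)" "E t = r"
    using r by (metis imageE)
  have Deq: "D k L s = (\<lambda>t. s @ t) ` vecs (k - L)"
    using assms(1) s by (intro D_eq) (auto simp: vecs_def)
  show ?thesis
  proof (rule ex1I[of _ "Poly (s @ t)"])
    show "Poly (s @ t) \<in> Poly ` D k L s \<and> map (poly (Poly (s @ t))) ?as = r"
      using t by (auto simp: Deq E_def)
  next
    fix p assume "p \<in> Poly ` D k L s \<and> map (poly p) ?as = r"
    then obtain t' where "t' \<in> vecs (k - L)" "p = Poly (s @ t')" "E t' = r"
      by (auto simp: Deq E_def)
    then show "p = Poly (s @ t)" using inj t by (auto dest: inj_onD)
  qed
qed

lemma g_poly_props:
  fixes \<alpha> :: "'a::{finite,field} list"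
  assumes "L \<le> k" "k - L \<le> length \<alpha>" "distinct \<alpha>" "0 \<notin> set \<alpha>"
    and "r \<in> vecs (k - L)" "s \<in> vecs L"
  shows "g_poly k L \<alpha> r s \<in> Poly ` D k L s"
    and "map (poly (g_poly k L \<alpha> r s)) (take (k - L) \<alpha>) = r"
  using theI'[OF g_poly_ex1[OF assms]] by (simp_all add: g_poly_def)

lemma U_enc_ket:
  fixes \<alpha> :: "'a::{finite,field} list"
  assumes "r \<in> vecs (k - L)" "s \<in> vecs L"
  shows "U_enc k L \<alpha> (ket r \<otimes>\<^sub>Q ket s) =
    ket (map (poly (g_poly k L \<alpha> r s)) (drop (k - L) \<alpha>))"
proof
  fix v
  let ?G = "\<lambda>r s. ket (map (poly (g_poly k L \<alpha> r s)) (drop (k - L) \<alpha>)) v"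
  have "U_enc k L \<alpha> (ket r \<otimes>\<^sub>Q ket s) v =
      (\<Sum>r'\<in>vecs (k - L). \<Sum>s'\<in>vecs L. (ket r \<otimes>\<^sub>Q ket s) (r' @ s') * ?G r' s')"
    by (simp add: U_enc_def scal_def sum_state_apply)
  also have "\<dots> = (\<Sum>r'\<in>vecs (k - L). if r' = r then
      (\<Sum>s'\<in>vecs L. if s' = s then ?G r s else 0) else 0)"
  proof (rule sum.cong[OF refl])
    fix r' :: "'a list" assume r': "r' \<in> vecs (k - L)"
    have "(ket r \<otimes>\<^sub>Q ket s) (r' @ s') = ket r r' * ket s s'" for s'
      using r' assms by (intro tensor_append[of _ "k - L"]) (auto simp: qudits_def ket_eq vecs_def)
    then have "(ket r \<otimes>\<^sub>Q ket s) (r' @ s') * ?G r' s' =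
        (if r' = r then if s' = s then ?G r s else 0 else 0)" for s'
      by (simp add: ket_eq[of r] ket_eq[of s])
    then show "(\<Sum>s'\<in>vecs L. (ket r \<otimes>\<^sub>Q ket s) (r' @ s') * ?G r' s') =
        (if r' = r then (\<Sum>s'\<in>vecs L. if s' = s then ?G r s else 0) else 0)"
      by simp
  qed
  also have "\<dots> = ?G r s" using assms by (simp add: sum.delta)
  finally show "U_enc k L \<alpha> (ket r \<otimes>\<^sub>Q ket s) v = ?G r s" .
qed

definition enc_map :: "nat \<Rightarrow> nat \<Rightarrow> 'a list \<Rightarrow> 'a list \<Rightarrow> 'a::field list" where
  "enc_map k L \<alpha> x =
     map (poly (g_poly k L \<alpha> (take (k - L) x) (drop (k - L) x))) (drop (k - L) \<alpha>)"

lemma enc_map_bij: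
  fixes \<alpha> :: "'a::{finite,field} list"
  assumes "L \<le> k" "length \<alpha> = 2 * k - L" "distinct \<alpha>" "0 \<notin> set \<alpha>"
  shows "bij_betw (enc_map k L \<alpha>) (vecs k) (vecs k)"
proof -
  let ?as = "drop (k - L) \<alpha>"
  have len: "length ?as = k" using assms by simp
  have inj: "inj_on (enc_map k L \<alpha>) (vecs k)"
  proof (rule inj_onI)
    fix x y :: "'a list"
    assume xy: "x \<in> vecs k" "y \<in> vecs k" "enc_map k L \<alpha> x = enc_map k L \<alpha> y"
    let ?g = "\<lambda>x. g_poly k L \<alpha> (take (k - L) x) (drop (k - L) x)"
    have parts: "take (k - L) z \<in> vecs (k - L)" "drop (k - L) z \<in> vecs L" if "z \<in> vecs k" for z :: "'a list"
      using that assms(1) by (auto simp: vecs_def)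
    have "k - L \<le> length \<alpha>" using assms by simp
    note props = g_poly_props[OF assms(1) this assms(3,4)]
    have gx: "?g x \<in> Poly ` D k L (drop (k - L) x)" "map (poly (?g x)) (take (k - L) \<alpha>) = take (k - L) x"
      using props parts[OF xy(1)] by auto
    have gy: "?g y \<in> Poly ` D k L (drop (k - L) y)" "map (poly (?g y)) (take (k - L) \<alpha>) = take (k - L) y"
      using props parts[OF xy(2)] by auto
    obtain c where c: "c \<in> D k L (drop (k - L) x)" "?g x = Poly c" using gx(1) by blast
    obtain d where d: "d \<in> D k L (drop (k - L) y)" "?g y = Poly d" using gy(1) by blast
    have "c = d"
    proof (rule eval_inj)
      show "distinct ?as" using assms by simp
      show "length ?as = k" by (rule len)
      show "length c = k" "length d = k" using c d by (auto simp: D_def vecs_def)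
      show "poly (Poly c) a = poly (Poly d) a" if "a \<in> set ?as" for a
        using xy(3) that c(2) d(2) by (simp add: enc_map_def)
    qed
    then have "take (k - L) x = take (k - L) y" using c(2) d(2) gx(2) gy(2) by simp
    moreover have "drop (k - L) x = drop (k - L) y"
    proof (rule nth_equalityI)
      show "length (drop (k - L) x) = length (drop (k - L) y)"
        using xy by (simp add: vecs_def)
      fix i assume "i < length (drop (k - L) x)"
      then have "i < L" using xy(1) assms(1) by (simp add: vecs_def)
      then have "c ! i = drop (k - L) x ! i" "d ! i = drop (k - L) y ! i"
        using c(1) d(1) unfolding D_def by blast+
      then show "drop (k - L) x ! i = drop (k - L) y ! i" using \<open>c = d\<close> by simp
    qed
    ultimately show "x = y" by (metis append_take_drop_id)
  qed
  have "enc_map k L \<alpha> ` vecs k \<subseteq> vecs k"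
    using len by (auto simp: enc_map_def vecs_def)
  then have "enc_map k L \<alpha> ` vecs k = vecs k"
    by (rule endo_inj_surj[OF finite_vecs _ inj])
  then show ?thesis using inj by (simp add: bij_betw_def)
qed

lemma U_enc_eq:
  fixes \<alpha> :: "'a::{finite,field} list"
  assumes "L \<le> k"
  shows "U_enc k L \<alpha> \<psi> v = (\<Sum>x\<in>vecs k. \<psi> x * ket (enc_map k L \<alpha> x) v)"
proof -
  have "U_enc k L \<alpha> \<psi> v = (\<Sum>(r, s)\<in>vecs (k - L) \<times> vecs L.
      \<psi> (r @ s) * ket (map (poly (g_poly k L \<alpha> r s)) (drop (k - L) \<alpha>)) v)"
    by (simp add: U_enc_def scal_def sum_state_apply sum.cartesian_product case_prod_unfold)
  also have "\<dots> = (\<Sum>x\<in>vecs k. \<psi> x * ket (enc_map k L \<alpha> x) v)"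
    by (rule sum.reindex_bij_witness[of _ "\<lambda>x. (take (k - L) x, drop (k - L) x)" "\<lambda>(r, s). r @ s"])
      (use assms in \<open>auto simp: vecs_def enc_map_def\<close>)
  finally show ?thesis .
qed

theorem unitary_U_enc:
  fixes \<alpha> :: "'a::{finite,field} list"
  assumes "L \<le> k" "length \<alpha> = 2 * k - L" "distinct \<alpha>" "0 \<notin> set \<alpha>"
  shows "unitary_map k k (U_enc k L \<alpha>)"
proof -
  let ?U = "U_enc k L \<alpha>" and ?G = "enc_map k L \<alpha>"
  note bij = enc_map_bij[OF assms]
  have at: "?U \<psi> (?G x) = \<psi> x" if x: "x \<in> vecs k" for \<psi> x
  proof -
    have "?U \<psi> (?G x) = (\<Sum>y\<in>vecs k. if y = x then \<psi> x else 0)"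
      unfolding U_enc_eq[OF assms(1)]
    proof (rule sum.cong[OF refl])
      fix y :: "'a list" assume y: "y \<in> vecs k"
      have "?G x = ?G y \<longleftrightarrow> y = x"
        using bij_betw_imp_inj_on[OF bij] x y by (auto dest: inj_onD)
      then show "\<psi> y * ket (?G y) (?G x) = (if y = x then \<psi> x else 0)"
        by (simp add: ket_eq)
    qed
    then show ?thesis using x by (simp add: sum.delta)
  qed
  have len: "length (?G x) = k" for x using assms by (simp add: enc_map_def)
  have maps: "?U \<psi> \<in> qudits k" for \<psi>
    unfolding qudits_def
  proof (intro CollectI allI impI)
    fix v :: "'a list" assume "length v \<noteq> k"
    then have "v \<noteq> ?G x" for x using len by metis
    then show "?U \<psi> v = 0" by (simp add: U_enc_eq[OF assms(1)] ket_eq)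
  qed
  have surj: "?U ` qudits k = qudits k"
  proof (intro equalityI subsetI)
    fix \<phi> :: "'a state" assume \<phi>: "\<phi> \<in> qudits k"
    define \<psi> :: "'a state" where "\<psi> v = (if length v = k then \<phi> (?G v) else 0)" for v
    have "?U \<psi> v = \<phi> v" for v
    proof (cases "length v = k")
      case True
      then obtain x where "x \<in> vecs k" "v = ?G x"
        using bij_betw_imp_surj_on[OF bij] by (auto simp: vecs_def)
      then show ?thesis using at by (simp add: \<psi>_def vecs_def)
    next
      case False
      then show ?thesis using maps[of \<psi>] \<phi> by (simp add: qudits_def)
    qed
    moreover have "\<psi> \<in> qudits k" by (simp add: \<psi>_def qudits_def)
    ultimately show "\<phi> \<in> ?U ` qudits k" by (metis ext image_eqI)
  qed (use maps in auto)
  have inner: "braket k (?U \<phi>) (?U \<psi>) = braket k \<phi> \<psi>" for \<phi> \<psi>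
    unfolding braket_def
    by (subst sum.reindex_bij_betw[OF bij, symmetric]) (simp add: at)
  have add: "?U (\<phi> + \<psi>) = ?U \<phi> + ?U \<psi>" for \<phi> \<psi>
    by (rule ext) (simp add: U_enc_eq[OF assms(1)] distrib_right sum.distrib)
  have scal: "?U (a *\<^sub>Q \<phi>) = a *\<^sub>Q ?U \<phi>" for a \<phi>
    by (rule ext) (simp add: U_enc_eq[OF assms(1)] scal_def sum_distrib_left mult.assoc)
  show ?thesis
    unfolding unitary_map_def using surj inner add scal by simp
qed

end

(*
  The amplitude of the dealer's state at r, y is nonzero only for y = r @ s, so the advance-sharing
  procedure yields a uniform superposition, over the basis labels r of the advance shares, of
  the evaluation vectors of the polynomials g_{r,s}. Interpolation at the first k - L points makes
  c -> (f_c(alpha_1), ..., f_c(alpha_{k-L})) a bijection from D(s) onto F_q^{k-L} with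
  g_{r,s} = f_c, which turns this sum into the one over D(s).
*)

theory Submission
  imports Defs
begin

lemma ket_in_qudits: "ket v \<in> qudits (length v)"
  by (auto simp: qudits_def ket_eq)

lemma tensor_in_qudits:
  assumes "\<phi> \<in> qudits m" "\<psi> \<in> qudits m'"
  shows "\<phi> \<otimes>\<^sub>Q \<psi> \<in> qudits (m + m')"
  unfolding qudits_def
proof (intro CollectI allI impI)
  fix v :: "'a list" assume v: "length v \<noteq> m + m'"
  show "(\<phi> \<otimes>\<^sub>Q \<psi>) v = 0"
    unfolding tensor_def
  proof (intro sum.neutral ballI)
    fix i assume "i \<in> {..length v}"
    then have "length (take i v) \<noteq> m \<or> length (drop i v) \<noteq> m'" using v by auto
    then show "\<phi> (take i v) * \<psi> (drop i v) = 0" using assms by (auto simp: qudits_def)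
  qed
qed

text \<open>In the sum over splittings only the cut after \<open>length x\<close> can contribute,
  and both sides vanish on lists of any other total length. Products of kets thus become statements
  about concatenated lists.\<close>

lemma tensor_ket_append: "ket x \<otimes>\<^sub>Q ket y = ket (x @ y)"
proof
  fix v
  show "(ket x \<otimes>\<^sub>Q ket y) v = ket (x @ y) v"
  proof (cases "length v = length x + length y")
    case True
    have "(ket x \<otimes>\<^sub>Q ket y) (take (length x) v @ drop (length x) v) =
        ket x (take (length x) v) * ket y (drop (length x) v)"
      using True by (intro tensor_append[OF ket_in_qudits]) simp
    moreover have "v = x @ y \<longleftrightarrow> take (length x) v = x \<and> drop (length x) v = y"
      by (metis append_eq_conv_conj)
    ultimately show ?thesis by (simp add: ket_eq)
  next
    case False
    then show ?thesis
      using tensor_in_qudits[OF ket_in_qudits[of x] ket_in_qudits[of y]]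
      by (auto simp: qudits_def ket_eq)
  qed
qed

lemma Psi_in_qudits: "Psi m \<in> qudits (m + m)"
  unfolding Psi_def tensor_ket_append
  by (auto simp: scal_def sum_state_apply qudits_def ket_eq vecs_def intro!: sum.neutral)

text \<open>As \<open>r\<close> and \<open>x\<close> both have length \<open>m\<close>,
  \<open>r @ r = x @ y\<close> forces \<open>r = x\<close> and \<open>y = x\<close>, so at most one
  summand of \<open>Psi\<close> survives.\<close>

lemma Psi_append:
  assumes "x \<in> vecs m" "length y = m"
  shows "Psi m (x @ y :: 'a::finite list) =
    (if y = x then complex_of_real (1 / sqrt (real (CARD('a) ^ m))) else 0)"
proof -
  have "(\<Sum>r\<in>vecs m. ket (r @ r) (x @ y)) = (\<Sum>r\<in>vecs m. if r = x then (if y = x then 1 else 0) else 0)"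
    using assms by (intro sum.cong) (auto simp: ket_eq vecs_def)
  also have "\<dots> = (if y = x then 1 else 0)"
    using assms(1) by (subst sum.delta) auto
  finally show ?thesis
    by (simp add: Psi_def scal_def sum_state_apply tensor_ket_append)
qed

text \<open>Two cuts meet here: the tensor product joins its factors after \<open>2 * m\<close>
  qudits, whereas the dealer hands out the first \<open>m\<close>. Splitting \<open>y\<close> after
  \<open>m\<close> entries reconciles them.\<close>

lemma Psi_tensor_ket_append:
  assumes x: "x \<in> vecs m" and y: "y \<in> vecs (m + length s)"
  shows "(Psi m \<otimes>\<^sub>Q ket s) (x @ y :: 'a::finite list) =
    (if y = x @ s then complex_of_real (1 / sqrt (real (CARD('a) ^ m))) else 0)"
proof -
  have "(Psi m \<otimes>\<^sub>Q ket s) ((x @ take m y) @ drop m y) = Psi m (x @ take m y) * ket s (drop m y)"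
    using x y by (intro tensor_append[OF Psi_in_qudits]) (simp add: vecs_def)
  moreover have "Psi m (x @ take m y) =
      (if take m y = x then complex_of_real (1 / sqrt (real (CARD('a) ^ m))) else 0)"
    using y by (intro Psi_append x) (simp add: vecs_def)
  moreover have "y = x @ s \<longleftrightarrow> take m y = x \<and> drop m y = s"
    using x by (metis (mono_tags, lifting) append_eq_conv_conj append_take_drop_id mem_Collect_eq vecs_def)
  ultimately show ?thesis by (simp add: ket_eq)
qed

text \<open>\<open>op_tensor\<close> evaluates \<open>A\<close> and \<open>B\<close> only at kets,
  and for each \<open>r\<close> the amplitude leaves the single term \<open>y = r @ s\<close>: the
  dealer's half of \<open>Psi\<close> copies \<open>r\<close>.\<close>

lemma op_tensor_Psi_ket:
  fixes s :: "'a::finite list"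
  shows "op_tensor m (m + length s) A B (Psi m \<otimes>\<^sub>Q ket s) =
    complex_of_real (1 / sqrt (real (CARD('a) ^ m))) *\<^sub>Q
      (\<Sum>r\<in>vecs m. A (ket r) \<otimes>\<^sub>Q B (ket (r @ s)))"
proof
  fix v
  define C where "C = complex_of_real (1 / sqrt (real (CARD('a) ^ m)))"
  have "op_tensor m (m + length s) A B (Psi m \<otimes>\<^sub>Q ket s) v =
      (\<Sum>r\<in>vecs m. \<Sum>y\<in>vecs (m + length s).
        (Psi m \<otimes>\<^sub>Q ket s) (r @ y) * (A (ket r) \<otimes>\<^sub>Q B (ket y)) v)"
    by (simp add: op_tensor_def sum_state_apply scal_def)
  also have "\<dots> = (\<Sum>r\<in>vecs m. C * (A (ket r) \<otimes>\<^sub>Q B (ket (r @ s))) v)"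
  proof (rule sum.cong[OF refl])
    fix r :: "'a list" assume r: "r \<in> vecs m"
    have "(\<Sum>y\<in>vecs (m + length s). (Psi m \<otimes>\<^sub>Q ket s) (r @ y) * (A (ket r) \<otimes>\<^sub>Q B (ket y)) v) =
        (\<Sum>y\<in>vecs (m + length s). if y = r @ s then C * (A (ket r) \<otimes>\<^sub>Q B (ket (r @ s))) v else 0)"
      by (intro sum.cong refl) (simp add: Psi_tensor_ket_append[OF r] C_def)
    also have "\<dots> = C * (A (ket r) \<otimes>\<^sub>Q B (ket (r @ s))) v"
      using r by (subst sum.delta, simp, simp add: vecs_def)
    finally show "(\<Sum>y\<in>vecs (m + length s). (Psi m \<otimes>\<^sub>Q ket s) (r @ y) *
        (A (ket r) \<otimes>\<^sub>Q B (ket y)) v) = C * (A (ket r) \<otimes>\<^sub>Q B (ket (r @ s))) v" .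
  qed
  finally show "op_tensor m (m + length s) A B (Psi m \<otimes>\<^sub>Q ket s) v =
      (complex_of_real (1 / sqrt (real (CARD('a) ^ m))) *\<^sub>Q
        (\<Sum>r\<in>vecs m. A (ket r) \<otimes>\<^sub>Q B (ket (r @ s)))) v"
    by (simp add: scal_def sum_state_apply sum_distrib_left C_def)
qed

text \<open>\<open>Poly c\<close> meets the condition defining \<open>g_poly\<close> at its own
  values, so uniqueness of interpolation applies. This makes \<open>g_poly\<close> a left inverse of
  evaluation.\<close>

lemma g_poly_eqI:
  fixes \<alpha> :: "'a::{finite,field} list"
  assumes "L \<le> k" "k - L \<le> length \<alpha>" "distinct \<alpha>" "0 \<notin> set \<alpha>" "s \<in> vecs L"
    and "c \<in> D k L s"
  shows "g_poly k L \<alpha> (map (poly (Poly c)) (take (k - L) \<alpha>)) s = Poly c"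
  unfolding g_poly_def
  by (rule the1_equality[OF g_poly_ex1]) (use assms in \<open>auto simp: vecs_def\<close>)

lemma eval_bij_betw_D:
  fixes \<alpha> :: "'a::{finite,field} list"
  assumes "L \<le> k" "k - L \<le> length \<alpha>" "distinct \<alpha>" "0 \<notin> set \<alpha>" "s \<in> vecs L"
  shows "bij_betw (\<lambda>c. map (poly (Poly c)) (take (k - L) \<alpha>)) (D k L s) (vecs (k - L))"
    (is "bij_betw ?e _ _")
  unfolding bij_betw_def
proof (intro conjI equalityI subsetI)
  show "inj_on ?e (D k L s)"
  proof (rule inj_onI)
    fix c d assume cd: "c \<in> D k L s" "d \<in> D k L s" "?e c = ?e d"
    then have "Poly c = Poly d" using g_poly_eqI[OF assms] by metis
    \<comment> \<open>\<open>Poly\<close> forgets trailing zeros; the common length \<open>k\<close>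
      recovers the lists.\<close>
    then show "c = d" using cd Poly_eq_iff_length[of c d] by (simp add: D_def vecs_def)
  qed
next
  fix r assume "r \<in> ?e ` D k L s"
  then show "r \<in> vecs (k - L)" using assms(2) by (auto simp: vecs_def)
next
  fix r :: "'a list" assume "r \<in> vecs (k - L)"
  \<comment> \<open>The preimage is the coefficient list of the interpolant
    \<open>g_poly k L \<alpha> r s\<close>.\<close>
  then show "r \<in> ?e ` D k L s" using g_poly_props[OF assms(1-4) _ assms(5), of r] by auto
qed

theorem theorem5:
  fixes q k L n :: nat and \<alpha> s :: "'a::{finite,field} list"
  assumes "q = CARD('a)" and "primepow q"
    and "1 \<le> L" and "L \<le> k" and "n = 2 * k - L" and "n \<le> q - 1"
    and "length \<alpha> = n" and "distinct \<alpha>" and "0 \<notin> set \<alpha>"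
    and "length s = L"
  shows "op_tensor (k - L) k id (U_enc k L \<alpha>) (Psi (k - L) \<otimes>\<^sub>Q ket s) =
    complex_of_real (1 / sqrt (real (q ^ (k - L)))) *\<^sub>Q
      (\<Sum>c\<in>D k L s. ket (map (\<lambda>a. poly (Poly c) a) \<alpha>))"
proof -
  let ?m = "k - L" and ?g = "\<lambda>r. g_poly k L \<alpha> r s"
  have s: "s \<in> vecs L" using assms by (simp add: vecs_def)
  have hyps: "L \<le> k" "?m \<le> length \<alpha>" "distinct \<alpha>" "0 \<notin> set \<alpha>" using assms by auto
  have "id (ket r) \<otimes>\<^sub>Q U_enc k L \<alpha> (ket (r @ s)) = ket (map (poly (?g r)) \<alpha>)"
    if r: "r \<in> vecs ?m" for r
  proof -
    \<comment> \<open>The advance shares \<open>r\<close> are themselves the values of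
      \<open>?g r\<close> at the first \<open>?m\<close> points, so both kets merge into one
      evaluation vector over all of \<open>\<alpha>\<close>.\<close>
    have "id (ket r) \<otimes>\<^sub>Q U_enc k L \<alpha> (ket (r @ s)) =
        ket (map (poly (?g r)) (take ?m \<alpha>) @ map (poly (?g r)) (drop ?m \<alpha>))"
      by (simp add: tensor_ket_append[symmetric] U_enc_ket[OF r s] g_poly_props(2)[OF hyps r s])
    then show ?thesis by (simp flip: map_append)
  qed
  then have "(\<Sum>r\<in>vecs ?m. id (ket r) \<otimes>\<^sub>Q U_enc k L \<alpha> (ket (r @ s))) =
      (\<Sum>r\<in>vecs ?m. ket (map (poly (?g r)) \<alpha>))"
    by (rule sum.cong[OF refl])
  also have "\<dots> = (\<Sum>c\<in>D k L s. ket (map (poly (?g (map (poly (Poly c)) (take ?m \<alpha>)))) \<alpha>))"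
    by (rule sum.reindex_bij_betw[OF eval_bij_betw_D[OF hyps s], symmetric])
  also have "\<dots> = (\<Sum>c\<in>D k L s. ket (map (\<lambda>a. poly (Poly c) a) \<alpha>))"
    by (intro sum.cong refl) (simp add: g_poly_eqI[OF hyps s])
  finally show ?thesis
    \<comment> \<open>The widths agree because \<open>?m + length s = k\<close>, and the
      normalisations because \<open>q = CARD('a)\<close>.\<close>
    using op_tensor_Psi_ket[of ?m s id "U_enc k L \<alpha>"] assms by simp
qed

end
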